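(* Let $G$ be a finite abelian group with $|G|\ge 3$ and let $H$ be a transfer Krull monoid over $G$. Suppose that $G$ has the following property: there are $g_1,g_2\in G$ and minimal zero-sum sequences $U_1,U_2$ over $G$ such that $|U_1|=|U_2|=\mathsf D(G)$, $g_1g_2\mid U_1$ and $(g_1+g_2)\mid U_2$ (divisibility in $\mathcal F(G)$). Then there exists some $a^*\in H$ such that for all elements $a\in H$ with $\rho(\mathsf L(a))=\rho(H)$, the length set $\mathsf L(a^*a)$ is an interval with elasticity $\rho(H)$, i.e. $\rho(\mathsf L(a^*a))=\rho(H)$.
   Context: A monoid is a commutative cancellative semigroup with identity, written multiplicatively; $H^\times$ is its group of units; $a\simeq b$ means $aH=bH$. A non-unit $a\in H$ is an atom if $a=bc$ with $b,c\in H$ implies $b\in H^\times$ or $c\in H^\times$. $H$ is atomic if every non-unit is a finite product of atoms. For a non-unit $a$, the length set $\mathsf L(a)\subset\mathbb N$ is the set of all $k$ such that $a=u_1\cdots u_k$ with atoms $u_1,\dots,u_k$; for a unit $a$, $\mathsf L(a)=\{0\}$. For a finite nonempty $L\subset\mathbb N=\{1,2,\dots\}$, $\rho(L)=\max L/\min L$ is the elasticity of $L$, and $\rho(H)=\sup\rho(\mathsf L(a))$ over all non-units $a\in H$ is the elasticity of $H$. An interval is a finite nonempty set of consecutive integers, $[a,b]=\{x\in\mathbb Z: a\le x\le b\}$. For a finite abelian group $G$ (written additively), $\mathcal F(G)$ is the free abelian monoid with basis $G$ (written multiplicatively), whose elements are called sequences over $G$. For $S=g_1\cdots g_\ell\in\mathcal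 F(G)$, $|S|=\ell$ is its length and $\sigma(S)=g_1+\dots+g_\ell\in G$ its sum; $S$ is a zero-sum sequence if $\sigma(S)=0$. $\mathcal B(G)=\{S\in\mathcal F(G):\sigma(S)=0\}$ is the monoid of zero-sum sequences, its set of atoms is $\mathcal A(G)$, and atoms are called minimal zero-sum sequences over $G$. The Davenport constant is $\mathsf D(G)=\max\{|U|:U\in\mathcal A(G)\}$. A transfer homomorphism $\theta:H\to B$ between atomic monoids is a monoid homomorphism such that (1) $B=\theta(H)B^\times$ and $\theta^{-1}(B^\times)=H^\times$; (2) if $u\in H$, $b,c\in B$ and $\theta(u)=bc$, then there exist $v,w\in H$ with $u=vw$, $\theta(v)\simeq b$ and $\theta(w)\simeq c$. An (atomic) monoid $H$ is a transfer Krull monoid over $G$ if there exists a transfer homomorphism $\theta:H\to\mathcal B(G)$. *)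

theory Defs
  imports
    "HOL-Algebra.Divisibility"
    "HOL-Algebra.FiniteProduct"
    "HOL-Algebra.Coset"
    "HOL-Library.Extended_Real"
begin

section \<open>Atoms, factorizations and length sets\<close>

text \<open>Commutative cancellative monoids are structures satisfying \<^locale>\<open>comm_monoid_cancel\<close>.
  For such monoids \<^const>\<open>irreducible\<close> is the usual notion of an atom, see \<open>atoms_iff\<close>.\<close>

definition atoms :: "('a, 'm) monoid_scheme \<Rightarrow> 'a set"
  where "atoms H = {u \<in> carrier H. irreducible H u}"

definition atomic :: "('a, 'm) monoid_scheme \<Rightarrow> bool"
  where "atomic H \<longleftrightarrow>
    (\<forall>a \<in> carrier H - Units H. \<exists>us. set us \<subseteq> carrier H \<and> factors H us a)"

definition length_set :: "('a, 'm) monoid_scheme \<Rightarrow> 'a \<Rightarrow> nat set"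
  where "length_set H a =
    (if a \<in> Units H then {0} else {length us | us. set us \<subseteq> carrier H \<and> factors H us a})"

text \<open>The elasticity of a finite nonempty set of positive integers is the quotient of its maximum
  by its minimum. Infinite sets get the value \<open>\<infinity>\<close>. For the length set \<open>{0}\<close> of a unit
  the quotient is the junk value \<open>0 / 0 = 0\<close>, which is never the elasticity of an
  atomic monoid with a non-unit.\<close>

definition set_elasticity :: "nat set \<Rightarrow> ereal"
  where "set_elasticity L = (if finite L then ereal (real (Max L) / real (Min L)) else \<infinity>)"

definition elasticity :: "('a, 'm) monoid_scheme \<Rightarrow> ereal"
  where "elasticity H = (SUP a \<in> carrier H - Units H. set_elasticity (length_set H a))"

definition nat_interval :: "nat set \<Rightarrow> bool"
  where "nat_interval L \<longleftrightarrow> (\<exists>a b. a \<le> b \<and> L = {a..b})"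


section \<open>Zero-sum sequences\<close>

text \<open>A finite abelian group is a \<^locale>\<open>comm_group\<close> with finite carrier; its operation, written
  additively in the theory of zero-sum sequences, is \<open>\<otimes>\<^bsub>G\<^esub>\<close>, with neutral element \<open>\<one>\<^bsub>G\<^esub>\<close>.
  Sequences over \<open>G\<close> are multisets, so the product of two sequences is the multiset sum,
  and the length of a sequence is its \<^const>\<open>size\<close>.\<close>

definition seq_monoid :: "('g, 'm) monoid_scheme \<Rightarrow> 'g multiset monoid"
  where "seq_monoid G =
    \<lparr>carrier = {S. set_mset S \<subseteq> carrier G}, mult = (\<lambda>S T. S + T), one = {#}\<rparr>"

text \<open>The sum \<open>\<sigma>(S)\<close>, with equal terms collected; see \<open>seq_sum_empty\<close> and \<open>seq_sum_add_mset\<close>.\<close>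

definition seq_sum :: "('g, 'm) monoid_scheme \<Rightarrow> 'g multiset \<Rightarrow> 'g"
  where "seq_sum G S = (\<Otimes>\<^bsub>G\<^esub>g \<in> set_mset S. g [^]\<^bsub>G\<^esub> count S g)"

definition zero_sum_monoid :: "('g, 'm) monoid_scheme \<Rightarrow> 'g multiset monoid"
  where "zero_sum_monoid G =
    (seq_monoid G) \<lparr>carrier := {S \<in> carrier (seq_monoid G). seq_sum G S = \<one>\<^bsub>G\<^esub>}\<rparr>"

text \<open>The maximum exists when \<open>G\<close> is finite.\<close>

definition davenport :: "('g, 'm) monoid_scheme \<Rightarrow> nat"
  where "davenport G = Max (size ` atoms (zero_sum_monoid G))"


section \<open>Transfer Krull monoids\<close>

text \<open>The relation \<open>\<simeq>\<close>, i.e. equality of principal ideals, is \<^const>\<open>associated\<close>. Elements of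
  \<^term>\<open>hom H B\<close> need not preserve the identity in general, hence the second conjunct.\<close>

definition transfer_homomorphism ::
    "('a, 'm) monoid_scheme \<Rightarrow> ('b, 'n) monoid_scheme \<Rightarrow> ('a \<Rightarrow> 'b) \<Rightarrow> bool"
  where "transfer_homomorphism H B \<theta> \<longleftrightarrow>
    \<theta> \<in> hom H B \<and> \<theta> \<one>\<^bsub>H\<^esub> = \<one>\<^bsub>B\<^esub> \<and>
    carrier B = (\<theta> ` carrier H) <#>\<^bsub>B\<^esub> Units B \<and>
    {u \<in> carrier H. \<theta> u \<in> Units B} = Units H \<and>
    (\<forall>u \<in> carrier H. \<forall>b \<in> carrier B. \<forall>c \<in> carrier B. \<theta> u = b \<otimes>\<^bsub>B\<^esub> c \<longrightarrow>
      (\<exists>v \<in> carrier H. \<exists>w \<in> carrier H.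
        u = v \<otimes>\<^bsub>H\<^esub> w \<and> \<theta> v \<sim>\<^bsub>B\<^esub> b \<and> \<theta> w \<sim>\<^bsub>B\<^esub> c))"

definition transfer_krull_monoid :: "('a, 'm) monoid_scheme \<Rightarrow> ('g, 'n) monoid_scheme \<Rightarrow> bool"
  where "transfer_krull_monoid H G \<longleftrightarrow>
    comm_monoid_cancel H \<and> atomic H \<and> (\<exists>\<theta>. transfer_homomorphism H (zero_sum_monoid G) \<theta>)"


section \<open>Agreement with the textbook formulations\<close>

lemma (in comm_monoid_cancel) atoms_iff:
  "u \<in> atoms G \<longleftrightarrow> u \<in> carrier G - Units G \<and>
    (\<forall>b \<in> carrier G. \<forall>c \<in> carrier G. u = b \<otimes> c \<longrightarrow> b \<in> Units G \<or> c \<in> Units G)"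
    (is "?L \<longleftrightarrow> ?R")
proof
  assume ?L
  then show ?R
    unfolding atoms_def irreducible_def
    by (smt (verit) Diff_iff irreducible_def irreducible_prodE mem_Collect_eq)
next
  assume R: ?R
  have "b \<in> Units G" if b: "b \<in> carrier G" and p: "properfactor G b u" for b
  proof (rule ccontr)
    assume nb: "b \<notin> Units G"
    from p obtain c where c: "c \<in> carrier G" "u = b \<otimes> c"
      by (auto simp: properfactor_def factor_def)
    with R b nb have "c \<in> Units G" by blast
    with b c have "u divides b"
      by (metis Units_inv_closed Units_r_inv dividesI m_assoc r_one)
    with p show False by (simp add: properfactor_def)
  qed
  with R show ?L by (auto simp: atoms_def irreducible_def)
qed

lemma (in comm_monoid) seq_sum_empty: "seq_sum G {#} = \<one>"
  by (simp add: seq_sum_def)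

lemma (in comm_group) seq_sum_add_mset:
  assumes "g \<in> carrier G" "set_mset S \<subseteq> carrier G"
  shows "seq_sum G (add_mset g S) = g \<otimes> seq_sum G S"
proof -
  let ?A = "set_mset S - {g}"
  have *: "(\<Otimes>x \<in> ?A. x [^] count (add_mset g S) x) = (\<Otimes>x \<in> ?A. x [^] count S x)"
    using assms by (intro finprod_cong') auto
  have **: "seq_sum G T = g [^] count T g \<otimes> (\<Otimes>x \<in> ?A. x [^] count T x)"
    if "set_mset T \<subseteq> carrier G" "set_mset T - {g} = ?A" for T
  proof (cases "g \<in># T")
    case True
    then have "set_mset T = insert g ?A" using that by auto
    moreover have "(\<Otimes>x \<in> insert g ?A. x [^] count T x) =
        g [^] count T g \<otimes> (\<Otimes>x \<in> ?A. x [^] count T x)"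
      using assms by (intro finprod_insert) auto
    ultimately show ?thesis by (simp add: seq_sum_def)
  next
    case False
    then have "set_mset T = ?A" "count T g = 0" using that by (auto simp: not_in_iff)
    moreover have "(\<Otimes>x \<in> ?A. x [^] count T x) \<in> carrier G"
      using assms by (intro finprod_closed) auto
    ultimately show ?thesis by (simp add: seq_sum_def)
  qed
  have cl: "(\<Otimes>x \<in> ?A. x [^] count S x) \<in> carrier G"
    using assms by (intro finprod_closed) auto
  show ?thesis
    using **[of "add_mset g S"] **[of S] assms * cl nat_pow_mult[of g 1 "count S g"]
    by (auto simp: m_assoc[symmetric])
qed

end

theory Submission
  imports Defs
begin

text \<open>A transfer homomorphism preserves length sets (\<open>transfer_length_set\<close>), so everything takes
  place in the monoid of zero-sum sequences over \<open>G\<close>. Write \<open>D\<close> for its Davenport constant.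

  Count the neutral element twice in the length of a sequence. Then every atom has weight between
  \<open>2\<close> and \<open>D\<close>, and comparing weights gives \<open>2 * l \<le> D * k\<close> for all factorization lengths \<open>k\<close>, \<open>l\<close> of
  the same sequence (\<open>lengths_ratio\<close>). Hence no elasticity exceeds \<open>D / 2\<close>.

  The hypothesis on \<open>G\<close> provides one sequence with many lengths. Let \<open>U1\<close>, \<open>U2\<close> be the two given
  atoms of length \<open>D\<close>, let bars denote elementwise inversion, and let
  \<open>Q = U1 \<sqdot> bar U1 \<sqdot> U2 \<sqdot> bar U2\<close>. Besides the extreme lengths \<open>4\<close> (the four atoms) and \<open>2 * D\<close>
  (all pairs \<open>g \<sqdot> inv g\<close>), \<open>Q\<close> has the lengths \<open>5\<close> and \<open>2 * D - 1\<close>: exchanging \<open>g1 \<sqdot> g2\<close> in \<open>U1\<close> with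
  \<open>g1 \<otimes> g2\<close> in \<open>U2\<close> turns \<open>U1\<close> into an atom and \<open>U2\<close> into a sequence of length \<open>D + 1\<close> that is a
  product of exactly two atoms; and three of the pairs can be merged into \<open>W \<sqdot> bar W\<close> with the atom
  \<open>W = g1 \<sqdot> g2 \<sqdot> inv (g1 \<otimes> g2)\<close> (\<open>ex_four_lengths\<close>). So near both ends the length can be changed
  by one, and in a high power \<open>B\<close> of \<open>Q\<close> these changes fill all gaps: the lengths of \<open>B\<close> form the
  whole interval from \<open>p\<close> to \<open>q = p * D / 2\<close>, as long as desired (\<open>ex_long_interval\<close>).

  On the other hand, consecutive lengths of any sequence \<open>A\<close> differ by at most \<open>D * D\<close>: one
  factorization can be transformed into another by inserting the new atoms one at a time, and each
  insertion disturbs at most \<open>D\<close> of the old atoms (\<open>lengths_gap\<close>). If the interval of \<open>B\<close> is at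
  least that long, the sums of a length of \<open>B\<close> and a length of \<open>A\<close> cover everything from
  \<open>p + Min\<close> to \<open>q + Max\<close>, where \<open>Min\<close> and \<open>Max\<close> refer to the lengths of \<open>A\<close>. When \<open>A\<close> has elasticity
  \<open>D / 2\<close>, the ratio of these two bounds is \<open>D / 2\<close> again, so by the bound on ratios \<open>B + A\<close> has no
  other lengths (\<open>lengths_sum_interval\<close>). Any preimage of \<open>B\<close> is therefore the required element.\<close>

section \<open>Zero-sum sequences as a reduced cancellative monoid\<close>

context comm_group
begin

lemma zero_sum_monoid_carrier:
  "S \<in> carrier (zero_sum_monoid G) \<longleftrightarrow> set_mset S \<subseteq> carrier G \<and> seq_sum G S = \<one>"
  by (simp add: zero_sum_monoid_def seq_monoid_def)

lemma zero_sum_monoid_simps [simp]: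
  "mult (zero_sum_monoid G) S T = S + T" "one (zero_sum_monoid G) = {#}"
  by (simp_all add: zero_sum_monoid_def seq_monoid_def)

lemma seq_sum_singleton: "g \<in> carrier G \<Longrightarrow> seq_sum G {#g#} = g"
  using seq_sum_add_mset[of g "{#}"] by (simp add: seq_sum_empty)

lemma seq_sum_closed [simp]: "set_mset S \<subseteq> carrier G \<Longrightarrow> seq_sum G S \<in> carrier G"
  by (induction S) (auto simp: seq_sum_empty seq_sum_add_mset)

lemma seq_sum_union:
  "set_mset S \<subseteq> carrier G \<Longrightarrow> set_mset T \<subseteq> carrier G \<Longrightarrow>
    seq_sum G (S + T) = seq_sum G S \<otimes> seq_sum G T"
  by (induction S) (auto simp: seq_sum_empty seq_sum_add_mset m_assoc)

lemma zero_sum_union: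
  "S \<in> carrier (zero_sum_monoid G) \<Longrightarrow> T \<in> carrier (zero_sum_monoid G) \<Longrightarrow>
    S + T \<in> carrier (zero_sum_monoid G)"
  by (auto simp: zero_sum_monoid_carrier seq_sum_union)

lemma zero_sum_cancel_left:
  "S + T \<in> carrier (zero_sum_monoid G) \<Longrightarrow> S \<in> carrier (zero_sum_monoid G) \<Longrightarrow>
    T \<in> carrier (zero_sum_monoid G)"
  by (auto simp: zero_sum_monoid_carrier seq_sum_union)

lemma zero_sum_empty: "{#} \<in> carrier (zero_sum_monoid G)"
  by (simp add: zero_sum_monoid_carrier seq_sum_empty)

lemma zero_sum_monoid_cancel: "comm_monoid_cancel (zero_sum_monoid G)"
proof -
  have "comm_monoid (zero_sum_monoid G)"
    by (rule comm_monoidI) (auto simp: zero_sum_union zero_sum_empty)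
  then show ?thesis
    by (rule comm_monoid_cancelI) auto
qed

lemma zero_sum_monoid_Units: "Units (zero_sum_monoid G) = {{#}}"
  by (auto simp: Units_def zero_sum_empty)

lemma zero_sum_atoms_iff:
  "U \<in> atoms (zero_sum_monoid G) \<longleftrightarrow> U \<in> carrier (zero_sum_monoid G) \<and> U \<noteq> {#} \<and>
    (\<forall>S \<in> carrier (zero_sum_monoid G). \<forall>T \<in> carrier (zero_sum_monoid G).
      U = S + T \<longrightarrow> S = {#} \<or> T = {#})"
  using comm_monoid_cancel.atoms_iff[OF zero_sum_monoid_cancel, of U]
  by (auto simp: zero_sum_monoid_Units)

lemma atoms_zero_sum: "U \<in> atoms (zero_sum_monoid G) \<Longrightarrow> U \<in> carrier (zero_sum_monoid G)"
  by (simp add: zero_sum_atoms_iff)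


section \<open>Zero-sum free sequences and minimal zero-sum sequences\<close>

definition zero_sum_free :: "'a multiset \<Rightarrow> bool"
  where "zero_sum_free T \<longleftrightarrow>
    set_mset T \<subseteq> carrier G \<and> (\<forall>S. S \<subseteq># T \<longrightarrow> S \<noteq> {#} \<longrightarrow> seq_sum G S \<noteq> \<one>)"

lemma zero_sum_free_subset: "zero_sum_free T \<Longrightarrow> S \<subseteq># T \<Longrightarrow> zero_sum_free S"
  unfolding zero_sum_free_def by (meson set_mset_mono subset_mset.order_trans subset_trans)

text \<open>If a zero-sum sequence containing \<open>g\<close> is split into two zero-sum parts, one part avoids
  this occurrence of \<open>g\<close> and lies in the rest \<open>T\<close>. So minimality of the whole sequence is a property of
  \<open>T\<close> alone, inherited by subsequences; most atoms below are recognized in this way.\<close>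

lemma add_mset_atom_iff:
  assumes "add_mset g T \<in> carrier (zero_sum_monoid G)"
  shows "add_mset g T \<in> atoms (zero_sum_monoid G) \<longleftrightarrow> zero_sum_free T"
proof
  assume at: "add_mset g T \<in> atoms (zero_sum_monoid G)"
  show "zero_sum_free T"
    unfolding zero_sum_free_def
  proof (intro conjI allI impI notI)
    show "set_mset T \<subseteq> carrier G" using assms by (auto simp: zero_sum_monoid_carrier)
  next
    fix S assume S: "S \<subseteq># T" "S \<noteq> {#}" "seq_sum G S = \<one>"
    then obtain R where R: "T = S + R" by (metis subset_mset.add_diff_inverse)
    have Sc: "S \<in> carrier (zero_sum_monoid G)"
      using assms S R by (auto simp: zero_sum_monoid_carrier)
    moreover have eq: "add_mset g T = S + add_mset g R" using R by simp
    moreover have "add_mset g R \<in> carrier (zero_sum_monoid G)"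
      using zero_sum_cancel_left assms Sc eq by metis
    ultimately show False using at S unfolding zero_sum_atoms_iff
      by (metis add_mset_not_empty)
  qed
next
  assume zf: "zero_sum_free T"
  have "S = {#} \<or> R = {#}"
    if c: "S \<in> carrier (zero_sum_monoid G)" "R \<in> carrier (zero_sum_monoid G)"
      and e: "add_mset g T = S + R" for S R
  proof -
    have *: "Y = {#}" if "Y \<in> carrier (zero_sum_monoid G)" "add_mset g T = X + Y" "g \<in># X"
      for X Y
    proof -
      obtain X' where "X = add_mset g X'" using \<open>g \<in># X\<close> by (meson mset_add)
      then have "Y \<subseteq># T" using that by simp
      then show ?thesis using zf that(1) by (auto simp: zero_sum_free_def zero_sum_monoid_carrier)
    qed
    have "g \<in># S \<or> g \<in># R" using e by (metis union_iff union_single_eq_member)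
    then show ?thesis using *[of R S] *[of S R] c e by (auto simp: add.commute)
  qed
  then show "add_mset g T \<in> atoms (zero_sum_monoid G)"
    using assms by (auto simp: zero_sum_atoms_iff)
qed

lemma zero_sum_free_completion_atom:
  assumes "zero_sum_free T"
  shows "add_mset (inv (seq_sum G T)) T \<in> atoms (zero_sum_monoid G)"
  using assms
  by (subst add_mset_atom_iff) (auto simp: zero_sum_free_def zero_sum_monoid_carrier seq_sum_add_mset)

lemma zero_sum_free_empty: "zero_sum_free {#}"
  by (simp add: zero_sum_free_def)

lemma zero_sum_free_add_mset:
  assumes "zero_sum_free T" "g \<in> carrier G"
    and "\<And>S. S \<subseteq># T \<Longrightarrow> g \<otimes> seq_sum G S \<noteq> \<one>"
  shows "zero_sum_free (add_mset g T)"
  unfolding zero_sum_free_def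
proof (intro conjI allI impI)
  have Tc: "set_mset T \<subseteq> carrier G" using assms by (simp add: zero_sum_free_def)
  then show "set_mset (add_mset g T) \<subseteq> carrier G" using assms by simp
  fix S assume S: "S \<subseteq># add_mset g T" "S \<noteq> {#}"
  show "seq_sum G S \<noteq> \<one>"
  proof (cases "g \<in># S")
    case True
    then obtain S' where S': "S = add_mset g S'" by (meson mset_add)
    then have "S' \<subseteq># T" using S by simp
    moreover from this have "set_mset S' \<subseteq> carrier G" using Tc by (meson set_mset_mono subset_trans)
    ultimately show ?thesis using assms S' by (simp add: seq_sum_add_mset)
  next
    case False
    then have "S \<subseteq># T" using S by (metis diff_single_trivial subset_eq_diff_conv add_mset_add_single)
    then show ?thesis using assms S by (simp add: zero_sum_free_def)
  qed
qed

lemma zero_sum_free_singleton: "g \<in> carrier G \<Longrightarrow> g \<noteq> \<one> \<Longrightarrow> zero_sum_free {#g#}"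
  by (rule zero_sum_free_add_mset) (auto simp: zero_sum_free_empty seq_sum_empty)

lemma inverse_pair_atom:
  assumes "g \<in> carrier G" "g \<noteq> \<one>"
  shows "{#g, inv g#} \<in> atoms (zero_sum_monoid G)"
  using zero_sum_free_completion_atom[OF zero_sum_free_singleton[OF assms]] assms
  by (simp add: seq_sum_add_mset seq_sum_empty add_mset_commute)

lemma triple_atom:
  assumes "a \<in> carrier G" "b \<in> carrier G" "a \<noteq> \<one>" "b \<noteq> \<one>" "a \<otimes> b \<noteq> \<one>"
  shows "{#a, b, inv (a \<otimes> b)#} \<in> atoms (zero_sum_monoid G)"
proof -
  have "zero_sum_free {#a, b#}"
  proof (rule zero_sum_free_add_mset)
    fix S assume "S \<subseteq># {#b#}"
    then have "S = {#} \<or> S = {#b#}" 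
      by (metis subset_mset.antisym_conv1 mset_subset_size size_single size_eq_0_iff_empty less_one)
    then show "a \<otimes> seq_sum G S \<noteq> \<one>"
      using assms by (auto simp: seq_sum_add_mset seq_sum_empty)
  qed (use assms in \<open>auto simp: zero_sum_free_singleton\<close>)
  from zero_sum_free_completion_atom[OF this] show ?thesis
    using assms by (simp add: seq_sum_add_mset seq_sum_empty add_mset_commute)
qed

text \<open>Only the sum of the removed element matters for \<open>add_mset_atom_iff\<close>, and \<open>T\<close> remains
  zero-sum free as a subsequence.\<close>

lemma merged_atom:
  assumes "add_mset g1 (add_mset g2 T) \<in> atoms (zero_sum_monoid G)"
  shows "add_mset (g1 \<otimes> g2) T \<in> atoms (zero_sum_monoid G)"
proof -
  have c: "set_mset T \<subseteq> carrier G" "g1 \<in> carrier G" "g2 \<in> carrier G"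
    using atoms_zero_sum[OF assms] by (auto simp: zero_sum_monoid_carrier)
  have "add_mset (g1 \<otimes> g2) T \<in> carrier (zero_sum_monoid G)"
    using atoms_zero_sum[OF assms] c by (auto simp: zero_sum_monoid_carrier seq_sum_add_mset m_assoc)
  moreover have "zero_sum_free (add_mset g2 T)"
    using add_mset_atom_iff atoms_zero_sum assms by blast
  then have "zero_sum_free T" by (rule zero_sum_free_subset) simp
  ultimately show ?thesis by (simp add: add_mset_atom_iff)
qed

text \<open>As \<open>T\<close> is zero-sum free, neither part of a nontrivial zero-sum splitting lies in \<open>T\<close>, so
  each part contains exactly one of \<open>g1\<close>, \<open>g2\<close>. Each part then consists of one element and a
  zero-sum free rest, and is an atom.\<close>

lemma split_two_atoms:
  assumes U: "add_mset (g1 \<otimes> g2) T \<in> atoms (zero_sum_monoid G)"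
    and g: "g1 \<in> carrier G" "g2 \<in> carrier G"
    and na: "add_mset g1 (add_mset g2 T) \<notin> atoms (zero_sum_monoid G)"
  obtains X Y where "X \<in> atoms (zero_sum_monoid G)" "Y \<in> atoms (zero_sum_monoid G)"
    "add_mset g1 (add_mset g2 T) = X + Y"
proof -
  let ?B = "carrier (zero_sum_monoid G)"
  have zf: "zero_sum_free T" using add_mset_atom_iff atoms_zero_sum U by blast
  then have c: "set_mset T \<subseteq> carrier G" by (simp add: zero_sum_free_def)
  have B: "add_mset g1 (add_mset g2 T) \<in> ?B"
    using atoms_zero_sum[OF U] c g by (auto simp: zero_sum_monoid_carrier seq_sum_add_mset m_assoc)
  obtain S R where SR: "S \<in> ?B" "R \<in> ?B" "S \<noteq> {#}" "R \<noteq> {#}"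
    "add_mset g1 (add_mset g2 T) = S + R"
    using na B unfolding zero_sum_atoms_iff by auto
  have nsub: "\<not> X \<subseteq># T" if "X \<in> ?B" "X \<noteq> {#}" for X
    using zf that by (auto simp: zero_sum_free_def zero_sum_monoid_carrier)
  have *: "X \<in> atoms (zero_sum_monoid G) \<and> Y \<in> atoms (zero_sum_monoid G)"
    if X: "X \<in> ?B" "Y \<in> ?B" "X \<noteq> {#}" "Y \<noteq> {#}"
    and e: "add_mset g1 (add_mset g2 T) = X + Y" and "g1 \<in># X" for X Y
  proof -
    obtain X' where X': "X = add_mset g1 X'" using \<open>g1 \<in># X\<close> by (meson mset_add)
    then have e': "add_mset g2 T = X' + Y" using e by simp
    have "g2 \<notin># X'"
    proof
      assume "g2 \<in># X'"
      then obtain X'' where "X' = add_mset g2 X''" by (meson mset_add)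
      then have "Y \<subseteq># T" using e' by simp
      then show False using nsub X by blast
    qed
    then obtain Y' where Y': "Y = add_mset g2 Y'"
      using e' by (metis mset_add union_iff union_single_eq_member)
    have "T = X' + Y'" using e' Y' by simp
    then have "zero_sum_free X'" "zero_sum_free Y'"
      using zf zero_sum_free_subset by (metis mset_subset_eq_add_left mset_subset_eq_add_right)+
    then show ?thesis using X X' Y' by (simp add: add_mset_atom_iff)
  qed
  have "g1 \<in># S \<or> g1 \<in># R" using SR(5) by (metis union_iff union_single_eq_member)
  then show thesis using *[of S R] *[of R S] SR that by (metis add.commute)
qed

lemma seq_sum_inv:
  "set_mset S \<subseteq> carrier G \<Longrightarrow> seq_sum G (image_mset (m_inv G) S) = inv (seq_sum G S)"
proof (induction S)
  case (add x S)
  have "set_mset (image_mset (m_inv G) S) \<subseteq> carrier G" using add.prems by auto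
  then show ?case using add by (simp add: seq_sum_add_mset inv_mult)
qed (simp add: seq_sum_empty)

lemma inv_atom:
  assumes "U \<in> atoms (zero_sum_monoid G)"
  shows "image_mset (m_inv G) U \<in> atoms (zero_sum_monoid G)"
proof -
  obtain g T where U: "U = add_mset g T" using assms unfolding zero_sum_atoms_iff by (meson multiset_cases)
  then have zf: "zero_sum_free T" using add_mset_atom_iff atoms_zero_sum assms by blast
  have "zero_sum_free (image_mset (m_inv G) T)"
    unfolding zero_sum_free_def
  proof (intro conjI allI impI)
    show "set_mset (image_mset (m_inv G) T) \<subseteq> carrier G" using zf by (auto simp: zero_sum_free_def)
    fix S assume "S \<subseteq># image_mset (m_inv G) T" "S \<noteq> {#}"
    then obtain R where R: "R \<subseteq># T" "S = image_mset (m_inv G) R"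
      by (metis image_mset_union image_mset_eq_plusD mset_subset_eq_exists_conv mset_subset_eq_add_left)
    then have "R \<noteq> {#}" "set_mset R \<subseteq> carrier G" using \<open>S \<noteq> {#}\<close> zf zero_sum_free_subset
      by (auto simp: zero_sum_free_def)
    then show "seq_sum G S \<noteq> \<one>" using R zf by (simp add: seq_sum_inv zero_sum_free_def inv_eq_1_iff)
  qed
  moreover have "image_mset (m_inv G) U \<in> carrier (zero_sum_monoid G)"
    using atoms_zero_sum[OF assms] by (auto simp: zero_sum_monoid_carrier seq_sum_inv)
  ultimately show ?thesis using U by (simp add: add_mset_atom_iff)
qed


text \<open>The sums of the initial segments of a zero-sum free sequence are pairwise distinct, since
  the quotient of two of them is the sum of a subsequence. This bound makes the maximum in the
  definition of the Davenport constant meaningful.\<close>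

lemma atom_size_le_order:
  assumes "finite (carrier G)" "U \<in> atoms (zero_sum_monoid G)"
  shows "size U \<le> order G"
proof -
  obtain g T where U: "U = add_mset g T"
    using assms(2) unfolding zero_sum_atoms_iff by (meson multiset_cases)
  then have zf: "zero_sum_free T" using add_mset_atom_iff atoms_zero_sum assms by blast
  obtain xs where xs: "mset xs = T" by (meson ex_mset)
  define f where "f i = seq_sum G (mset (take i xs))" for i
  have sub: "set (take i xs) \<subseteq> carrier G" "set (drop i xs) \<subseteq> carrier G" for i
    using zf xs set_take_subset[of i xs] set_drop_subset[of i xs]
    unfolding zero_sum_free_def by (metis set_mset_mset subset_trans)+
  have neq: "f i \<noteq> f j" if ij: "i < j" "j \<le> length xs" for i j
  proof
    assume eq: "f i = f j"
    let ?S = "mset (take (j - i) (drop i xs))"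
    have "take j xs = take i xs @ take (j - i) (drop i xs)"
      using ij by (metis le_add_diff_inverse less_imp_le_nat take_add)
    then have "mset (take j xs) = mset (take i xs) + ?S" by simp
    moreover have Sc: "set_mset ?S \<subseteq> carrier G" using sub(2)[of i] set_take_subset by fastforce
    ultimately have "f j = f i \<otimes> seq_sum G ?S"
      using sub(1)[of i] by (simp add: f_def seq_sum_union)
    moreover have "f i \<in> carrier G" "seq_sum G ?S \<in> carrier G"
      using sub(1)[of i] Sc by (auto simp: f_def)
    ultimately have "seq_sum G ?S = \<one>" using eq by simp
    moreover have "?S \<noteq> {#}" using ij by simp
    moreover have "?S \<subseteq># T"
      unfolding xs[symmetric]
      by (metis append_take_drop_id mset_append mset_subset_eq_add_left mset_subset_eq_add_right
          subset_mset.order_trans)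
    ultimately show False using zf by (simp add: zero_sum_free_def)
  qed
  have "inj_on f {..length xs}"
    by (rule linorder_inj_onI) (use neq in auto)
  moreover have "f ` {..length xs} \<subseteq> carrier G" using sub(1) by (auto simp: f_def)
  ultimately have "card {..length xs} \<le> order G"
    unfolding order_def using assms(1) card_inj_on_le by blast
  then show ?thesis using U xs by (simp add: size_mset[symmetric] del: size_mset)
qed

lemma atom_size_le_davenport:
  assumes "finite (carrier G)" "U \<in> atoms (zero_sum_monoid G)"
  shows "size U \<le> davenport G"
proof -
  have "size ` atoms (zero_sum_monoid G) \<subseteq> {..order G}"
    using atom_size_le_order[OF assms(1)] by auto
  then have "finite (size ` atoms (zero_sum_monoid G))" by (rule finite_subset) simp
  then show ?thesis unfolding davenport_def using assms(2) by simp
qed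


section \<open>Factorization lengths of zero-sum sequences\<close>

abbreviation lengths :: "'a multiset \<Rightarrow> nat set"
  where "lengths A \<equiv> length_set (zero_sum_monoid G) A"

text \<open>Factorizations as multisets of atoms. This form also covers the empty sequence, the only
  unit, whose one factorization is empty.\<close>

lemma in_lengths_iff:
  "n \<in> lengths A \<longleftrightarrow>
    (\<exists>Z. set_mset Z \<subseteq> atoms (zero_sum_monoid G) \<and> \<Sum>\<^sub># Z = A \<and> size Z = n)"
proof -
  let ?M = "zero_sum_monoid G"
  have foldr: "foldr (\<otimes>\<^bsub>?M\<^esub>) us \<one>\<^bsub>?M\<^esub> = \<Sum>\<^sub># (mset us)" for us
    by (induction us) auto
  have fac: "set us \<subseteq> carrier ?M \<and> factors ?M us A \<longleftrightarrow> set us \<subseteq> atoms ?M \<and> \<Sum>\<^sub># (mset us) = A" for us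
    by (auto simp: factors_def foldr[simplified] atoms_def)
  show ?thesis
  proof (cases "A = {#}")
    case True
    have "Z = {#}" if "set_mset Z \<subseteq> atoms ?M" "\<Sum>\<^sub># Z = {#}" for Z
      using that by (cases Z) (auto simp: zero_sum_atoms_iff)
    then show ?thesis using True by (auto simp: length_set_def zero_sum_monoid_Units)
  next
    case False
    then have "n \<in> lengths A \<longleftrightarrow> (\<exists>us. set us \<subseteq> atoms ?M \<and> \<Sum>\<^sub># (mset us) = A \<and> length us = n)"
      by (auto simp: length_set_def zero_sum_monoid_Units fac)
    also have "\<dots> \<longleftrightarrow> (\<exists>Z. set_mset Z \<subseteq> atoms ?M \<and> \<Sum>\<^sub># Z = A \<and> size Z = n)"
      by (metis ex_mset set_mset_mset size_mset)
    finally show ?thesis .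
  qed
qed

lemma in_lengthsI:
  "set_mset Z \<subseteq> atoms (zero_sum_monoid G) \<Longrightarrow> \<Sum>\<^sub># Z = A \<Longrightarrow> size Z = n \<Longrightarrow> n \<in> lengths A"
  using in_lengths_iff by blast

lemma lengths_add:
  assumes "m \<in> lengths A" "n \<in> lengths B"
  shows "m + n \<in> lengths (A + B)"
proof -
  obtain Y Z where "set_mset Y \<subseteq> atoms (zero_sum_monoid G)" "\<Sum>\<^sub># Y = A" "size Y = m"
    "set_mset Z \<subseteq> atoms (zero_sum_monoid G)" "\<Sum>\<^sub># Z = B" "size Z = n"
    using assms by (auto simp: in_lengths_iff)
  then show ?thesis by (intro in_lengthsI[of "Y + Z"]) auto
qed

lemma one_in_lengths: "U \<in> atoms (zero_sum_monoid G) \<Longrightarrow> 1 \<in> lengths U"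
  by (rule in_lengthsI[of "{#U#}"]) auto

lemma two_in_lengths:
  "U \<in> atoms (zero_sum_monoid G) \<Longrightarrow> V \<in> atoms (zero_sum_monoid G) \<Longrightarrow> 2 \<in> lengths (U + V)"
  by (rule in_lengthsI[of "{#U, V#}"]) auto

lemma sum_atoms_zero_sum:
  "set_mset Z \<subseteq> atoms (zero_sum_monoid G) \<Longrightarrow> \<Sum>\<^sub># Z \<in> carrier (zero_sum_monoid G)"
  by (induction Z) (auto simp: zero_sum_empty zero_sum_union atoms_zero_sum)

lemma ex_length: "A \<in> carrier (zero_sum_monoid G) \<Longrightarrow> \<exists>n. n \<in> lengths A"
proof (induction "size A" arbitrary: A rule: less_induct)
  case less
  consider "A = {#}" | "A \<in> atoms (zero_sum_monoid G)"
    | S T where "S \<in> carrier (zero_sum_monoid G)" "T \<in> carrier (zero_sum_monoid G)"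
      "A = S + T" "S \<noteq> {#}" "T \<noteq> {#}"
    using less.prems zero_sum_atoms_iff by blast
  then show ?case
  proof cases
    case 1
    then show ?thesis by (intro exI in_lengthsI[of "{#}"]) auto
  next
    case 2
    then show ?thesis using one_in_lengths by blast
  next
    case 3
    then have "size S < size A" "size T < size A" by (simp_all add: nonempty_has_size)
    then show ?thesis using less.hyps 3 lengths_add by metis
  qed
qed

lemma size_factorization_le:
  "set_mset Z \<subseteq> atoms (zero_sum_monoid G) \<Longrightarrow> size Z \<le> size (\<Sum>\<^sub># Z)"
proof (induction Z)
  case (add U Z)
  then have "U \<noteq> {#}" by (simp add: zero_sum_atoms_iff)
  then have "1 \<le> size U" by (simp add: Suc_le_eq nonempty_has_size)
  then show ?case using add by simp
qed simp

lemma size_sum_atoms_le: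
  assumes "finite (carrier G)" "set_mset Z \<subseteq> atoms (zero_sum_monoid G)"
  shows "size (\<Sum>\<^sub># Z) \<le> davenport G * size Z"
  using assms(2)
proof (induction Z)
  case (add U Z)
  then show ?case using atom_size_le_davenport[OF assms(1), of U] by simp
qed simp

text \<open>The factorization into the pairs \<open>{#g, inv g#}\<close>; the element \<open>\<one>\<close> is excluded because
  \<open>{#\<one>, \<one>#}\<close> is not an atom.\<close>

lemma pairing_length:
  assumes "set_mset S \<subseteq> carrier G" "\<one> \<notin># S"
  shows "size S \<in> lengths (S + image_mset (m_inv G) S)"
  using assms
proof (induction S)
  case empty
  show ?case by (rule in_lengthsI[of "{#}"]) auto
next
  case (add g S)
  have "1 \<in> lengths {#g, inv g#}"
    using add.prems by (intro one_in_lengths inverse_pair_atom) auto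
  from lengths_add[OF this add.IH] show ?case using add.prems by (simp add: add_mset_commute)
qed



section \<open>Gaps and ratios of factorization lengths\<close>

text \<open>Each element of \<open>V\<close> requires at most one further summand.\<close>

lemma subset_of_few_summands:
  "V \<subseteq># \<Sum>\<^sub># Z \<Longrightarrow> \<exists>Y. Y \<subseteq># Z \<and> V \<subseteq># \<Sum>\<^sub># Y \<and> size Y \<le> size V" for Z :: "'c multiset multiset"
proof (induction V)
  case (add g V)
  then obtain Y where Y: "Y \<subseteq># Z" "V \<subseteq># \<Sum>\<^sub># Y" "size Y \<le> size V"
    by (metis mset_subset_eq_insertD subset_mset.less_imp_le)
  show ?case
  proof (cases "add_mset g V \<subseteq># \<Sum>\<^sub># Y")
    case True
    then show ?thesis using Y by (metis le_SucI size_add_mset)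
  next
    case False
    obtain R where R: "Z = Y + R" using Y(1) by (metis subset_mset.add_diff_inverse)
    have "count (add_mset g V) g \<le> count (\<Sum>\<^sub># Z) g"
      using add.prems by (rule mset_subset_eq_count)
    moreover have "count (\<Sum>\<^sub># Y) g < count (add_mset g V) g"
    proof (rule ccontr)
      assume "\<not> ?thesis"
      then have "add_mset g V \<subseteq># \<Sum>\<^sub># Y" using Y(2) by (auto simp: subseteq_mset_def)
      then show False using False by simp
    qed
    moreover have "count (\<Sum>\<^sub># Z) g = count (\<Sum>\<^sub># Y) g + count (\<Sum>\<^sub># R) g" using R by simp
    ultimately have "count (\<Sum>\<^sub># R) g \<noteq> 0" by linarith
    then have "g \<in># \<Sum>\<^sub># R" by (meson count_inI)
    then obtain U where U: "U \<in># R" "g \<in># U" by auto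
    have "add_mset g V \<subseteq># U + \<Sum>\<^sub># Y"
      using U(2) Y(2) subset_mset.add_mono[of "{#g#}" U V "\<Sum>\<^sub># Y"] by simp
    moreover have "add_mset U Y \<subseteq># Z" using U(1) R by simp
    ultimately show ?thesis using Y(3) by (intro exI[of _ "add_mset U Y"]) simp
  qed
qed auto

text \<open>Let \<open>V\<close> be an atom of the target factorization \<open>Z'\<close>. It divides the product of at most
  \<open>size V\<close> atoms of \<open>Z\<close>; refactoring this product, of size at most \<open>D * D\<close>, as \<open>V\<close> times further atoms
  raises the length by at most \<open>D * D\<close>. The proof then continues with \<open>V\<close> cancelled on both sides.
  So the lengths met on the way lead from \<open>size Z\<close> to \<open>size Z'\<close> and never rise by more than \<open>D * D\<close>
  in one step.\<close>

lemma lengths_gap: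
  assumes fin: "finite (carrier G)"
    and "set_mset Z \<subseteq> atoms (zero_sum_monoid G)" "set_mset Z' \<subseteq> atoms (zero_sum_monoid G)"
    and "\<Sum>\<^sub># Z = \<Sum>\<^sub># Z'" "size Z \<le> x" "x \<le> size Z'"
  shows "\<exists>l \<in> lengths (\<Sum>\<^sub># Z). l \<le> x \<and> x \<le> l + davenport G * davenport G"
  using assms(2-)
proof (induction Z' arbitrary: Z x)
  case empty
  then show ?case by (intro bexI[of _ "size Z"] in_lengthsI[of Z]) auto
next
  case (add V Z')
  let ?D = "davenport G"
  have V: "V \<in> atoms (zero_sum_monoid G)" using add.prems by simp
  have "V \<subseteq># \<Sum>\<^sub># Z" using add.prems by simp
  then obtain Y where Y: "Y \<subseteq># Z" "V \<subseteq># \<Sum>\<^sub># Y" "size Y \<le> size V"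
    using subset_of_few_summands[of V Z] by auto
  obtain R where R: "Z = Y + R" using Y(1) by (metis subset_mset.add_diff_inverse)
  obtain B where B: "\<Sum>\<^sub># Y = V + B" using Y(2) by (metis subset_mset.add_diff_inverse)
  have Yat: "set_mset Y \<subseteq> atoms (zero_sum_monoid G)" and Rat: "set_mset R \<subseteq> atoms (zero_sum_monoid G)"
    using add.prems(1) R by auto
  have "B \<in> carrier (zero_sum_monoid G)"
    using zero_sum_cancel_left[of V B] sum_atoms_zero_sum[OF Yat] B atoms_zero_sum[OF V] by simp
  then obtain W where W: "set_mset W \<subseteq> atoms (zero_sum_monoid G)" "\<Sum>\<^sub># W = B"
    using ex_length in_lengths_iff by blast
  have eq: "\<Sum>\<^sub># (W + R) = \<Sum>\<^sub># Z'" using add.prems(3) R B W(2) by simp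
  have "size (add_mset V W) \<le> size (V + B)"
    using size_factorization_le[of "add_mset V W"] V W by simp
  also have "\<dots> \<le> ?D * size Y" using size_sum_atoms_le[OF fin Yat] B by simp
  also have "\<dots> \<le> ?D * ?D" using Y(3) atom_size_le_davenport[OF fin V] by simp
  finally have change: "size (add_mset V (W + R)) \<le> size Z + ?D * ?D" using R by simp
  \<comment> \<open>Either the next factorization is still at most \<open>x\<close> long, or \<open>x\<close> lies in the present jump.\<close>
  show ?case
  proof (cases "size (add_mset V (W + R)) \<le> x")
    case True
    then have "size (W + R) \<le> x - 1" "x - 1 \<le> size Z'" "x \<ge> 1" using add.prems by auto
    then obtain l where "l \<in> lengths (\<Sum>\<^sub># (W + R))" "l \<le> x - 1" "x - 1 \<le> l + ?D * ?D"
      using add.IH[of "W + R" "x - 1"] add.prems W Rat eq by auto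
    then show ?thesis
      using lengths_add[OF one_in_lengths[OF V]] \<open>x \<ge> 1\<close> eq add.prems(3)
      by (intro bexI[of _ "1 + l"]) auto
  next
    case False
    then show ?thesis using change add.prems
      by (intro bexI[of _ "size Z"] in_lengthsI[of Z]) auto
  qed
qed

lemma atom_containing_one:
  assumes "U \<in> atoms (zero_sum_monoid G)" "\<one> \<in># U"
  shows "U = {#\<one>#}"
proof -
  obtain R where R: "U = {#\<one>#} + R" using assms(2) by (metis add_mset_add_single mset_add add.commute)
  have "{#\<one>#} \<in> carrier (zero_sum_monoid G)"
    by (simp add: zero_sum_monoid_carrier seq_sum_add_mset seq_sum_empty)
  then show ?thesis using R assms(1) zero_sum_cancel_left unfolding zero_sum_atoms_iff
    by (metis add.right_neutral add_mset_not_empty)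
qed

text \<open>The atom \<open>{#\<one>#}\<close> is the only one of length less than two. The weight \<open>w\<close> counts \<open>\<one>\<close>
  twice, so that all atoms have weight at least two while none gets heavier than \<open>D\<close>.\<close>

lemma lengths_ratio:
  assumes fin: "finite (carrier G)" and D: "2 \<le> davenport G"
    and kl: "k \<in> lengths A" "l \<in> lengths A"
  shows "2 * l \<le> davenport G * k"
proof -
  define w where "w S = size S + count S \<one>" for S
  have wU: "2 \<le> w U \<and> w U \<le> davenport G" if U: "U \<in> atoms (zero_sum_monoid G)" for U
  proof (cases "\<one> \<in># U")
    case True
    then show ?thesis using atom_containing_one[OF U] D by (simp add: w_def)
  next
    case False
    have "size U \<noteq> 0" using U by (auto simp: zero_sum_atoms_iff)
    moreover have "size U \<noteq> 1"
    proof
      assume "size U = 1"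
      then obtain g where "U = {#g#}" by (metis One_nat_def size_1_singleton_mset)
      moreover from this have "g \<in> carrier G" "seq_sum G {#g#} = \<one>"
        using atoms_zero_sum[OF U] by (auto simp: zero_sum_monoid_carrier)
      ultimately show False using False by (simp add: seq_sum_singleton)
    qed
    ultimately have "2 \<le> size U" by linarith
    then show ?thesis
      using False atom_size_le_davenport[OF fin U] by (simp add: w_def not_in_iff)
  qed
  have wZ: "2 * size Z \<le> w (\<Sum>\<^sub># Z) \<and> w (\<Sum>\<^sub># Z) \<le> davenport G * size Z"
    if "set_mset Z \<subseteq> atoms (zero_sum_monoid G)" for Z
    using that
  proof (induction Z)
    case empty
    show ?case by (simp add: w_def)
  next
    case (add U Z)
    have "w (\<Sum>\<^sub># (add_mset U Z)) = w U + w (\<Sum>\<^sub># Z)" by (simp add: w_def)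
    then show ?case using add wU[of U] by auto
  qed
  show ?thesis using kl wZ unfolding in_lengths_iff by (metis order_trans)
qed

lemma finite_lengths:
  assumes "finite (carrier G)" "2 \<le> davenport G"
  shows "finite (lengths A)"
proof (cases "lengths A = {}")
  case False
  then obtain k where "k \<in> lengths A" by blast
  then have "lengths A \<subseteq> {..davenport G * k}" using lengths_ratio[OF assms] by force
  then show ?thesis by (rule finite_subset) simp
qed simp


section \<open>An element whose length set is a long interval\<close>

text \<open>In \<open>i\<close> of the \<open>N\<close> copies of \<open>Q\<close> the length is raised by \<open>m\<close>, and, independently, in \<open>r\<close> of
  them by \<open>1\<close>.\<close>

lemma lengths_repeat_mset:
  assumes Q: "{b, b + 1, b + m, b + m + 1} \<subseteq> lengths Q" and "i \<le> N" "r \<le> N"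
  shows "b * N + m * i + r \<in> lengths (repeat_mset N Q)"
  using assms(2,3)
proof (induction N arbitrary: i r)
  case 0
  then show ?case by (auto intro: in_lengthsI[of "{#}"])
next
  case (Suc N)
  define i0 r0 where "i0 = (if i = 0 then 0 else 1 :: nat)" and "r0 = (if r = 0 then 0 else 1 :: nat)"
  have "b + m * i0 + r0 \<in> lengths Q" using Q by (auto simp: i0_def r0_def)
  moreover have "b * N + m * (i - i0) + (r - r0) \<in> lengths (repeat_mset N Q)"
    using Suc by (intro Suc.IH) (auto simp: i0_def r0_def)
  ultimately have "(b + m * i0 + r0) + (b * N + m * (i - i0) + (r - r0)) \<in> lengths (Q + repeat_mset N Q)"
    by (rule lengths_add)
  moreover have "m * i0 + m * (i - i0) = m * i" "r0 + (r - r0) = r"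
    by (auto simp: i0_def r0_def simp flip: distrib_left)
  ultimately show ?case by (simp add: algebra_simps)
qed

text \<open>The possible values of \<open>r\<close> cover \<open>N + 1\<close> consecutive numbers, more than the step \<open>m\<close> between
  consecutive values of \<open>i\<close>.\<close>

lemma interval_lengths_repeat_mset:
  assumes Q: "{b, b + 1, b + m, b + m + 1} \<subseteq> lengths Q" and "m \<le> N" "m > 0"
  shows "{b * N..(b + m + 1) * N} \<subseteq> lengths (repeat_mset N Q)"
proof
  fix n assume n: "n \<in> {b * N..(b + m + 1) * N}"
  define x where "x = n - b * N"
  have x: "n = b * N + x" "x \<le> m * N + N" using n by (auto simp: x_def algebra_simps)
  \<comment> \<open>The minimum matters near the upper end, where division with remainder would use \<open>i > N\<close>.\<close>
  define i where "i = min (x div m) N"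
  have "x - m * i \<le> N"
  proof (cases "x div m \<le> N")
    case True
    then have "x - m * i = x mod m" by (simp add: i_def minus_mult_div_eq_mod)
    then show ?thesis using assms(2,3) mod_less_divisor[of m x] by linarith
  qed (use x in \<open>simp add: i_def min_def\<close>)
  moreover have "m * i \<le> x"
  proof -
    have "m * i \<le> m * (x div m)" by (simp add: i_def)
    also have "\<dots> \<le> x" by simp
    finally show ?thesis .
  qed
  ultimately show "n \<in> lengths (repeat_mset N Q)"
    using lengths_repeat_mset[OF Q, of i N "x - m * i"] x by (simp add: i_def)
qed

text \<open>The bound \<open>D \<ge> 3\<close> holds because atoms of length \<open>D \<ge> 2\<close>
  do not contain \<open>\<one>\<close>: with \<open>D = 2\<close>, the atom \<open>{#g1, g2#}\<close> would give \<open>g1 \<otimes> g2 = \<one>\<close>, which would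
  be an element of the other atom.\<close>

lemma ex_four_lengths:
  assumes fin: "finite (carrier G)"
    and U1: "add_mset g1 (add_mset g2 T1) \<in> atoms (zero_sum_monoid G)"
    and U2: "add_mset (g1 \<otimes> g2) T2 \<in> atoms (zero_sum_monoid G)"
    and s1: "size (add_mset g1 (add_mset g2 T1)) = davenport G"
    and s2: "size (add_mset (g1 \<otimes> g2) T2) = davenport G"
  shows "3 \<le> davenport G \<and> (\<exists>Q \<in> carrier (zero_sum_monoid G).
    {4, 5, 2 * davenport G - 1, 2 * davenport G} \<subseteq> lengths Q)"
proof -
  let ?n = "image_mset (m_inv G)" and ?D = "davenport G"
  define V1 where "V1 = add_mset g1 (add_mset g2 T1)"
  define V2 where "V2 = add_mset (g1 \<otimes> g2) T2"
  have V: "V1 \<in> atoms (zero_sum_monoid G)" "V2 \<in> atoms (zero_sum_monoid G)"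
    "?n V1 \<in> atoms (zero_sum_monoid G)" "?n V2 \<in> atoms (zero_sum_monoid G)"
    using U1 U2 inv_atom[OF U1] inv_atom[OF U2] by (auto simp: V1_def V2_def)
  have sV: "size V1 = ?D" "size V2 = ?D" using s1 s2 by (auto simp: V1_def V2_def)
  have c: "g1 \<in> carrier G" "g2 \<in> carrier G" "set_mset T1 \<subseteq> carrier G" "set_mset T2 \<subseteq> carrier G"
    using atoms_zero_sum[OF U1] atoms_zero_sum[OF U2] by (auto simp: zero_sum_monoid_carrier)
  have D2: "2 \<le> ?D" using s1 by simp
  then have no1: "\<one> \<notin># V1" "\<one> \<notin># V2"
    using atom_containing_one V sV by fastforce+
  then have n1: "g1 \<noteq> \<one>" "g2 \<noteq> \<one>" "g1 \<otimes> g2 \<noteq> \<one>" "\<one> \<notin># T1" "\<one> \<notin># T2"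
    by (auto simp: V1_def V2_def)
  have D3: "3 \<le> ?D"
  proof (rule ccontr)
    assume "\<not> 3 \<le> ?D"
    moreover have "size T1 + 2 = ?D" using s1 by simp
    ultimately have "size T1 = 0" by linarith
    then have "T1 = {#}" by simp
    then show False using atoms_zero_sum[OF U1] n1 c
      by (simp add: zero_sum_monoid_carrier seq_sum_add_mset seq_sum_empty)
  qed
  define Q where "Q = (V1 + ?n V1) + (V2 + ?n V2)"
  have "Q \<in> carrier (zero_sum_monoid G)"
    unfolding Q_def using V by (intro zero_sum_union atoms_zero_sum)
  moreover have "4 \<in> lengths Q"
  proof -
    have "2 \<in> lengths (V1 + ?n V1)" "2 \<in> lengths (V2 + ?n V2)"
      using V by (simp_all add: two_in_lengths)
    from lengths_add[OF this] show ?thesis by (simp add: Q_def)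
  qed
  moreover have "2 * ?D \<in> lengths Q"
  proof -
    have "?D \<in> lengths (V1 + ?n V1)" "?D \<in> lengths (V2 + ?n V2)"
      using pairing_length[of V1] pairing_length[of V2] V sV no1 atoms_zero_sum
      by (auto simp: zero_sum_monoid_carrier)
    from lengths_add[OF this] show ?thesis by (simp add: Q_def mult_2)
  qed
  moreover have "5 \<in> lengths Q"
  proof -
    \<comment> \<open>This zero-sum sequence has length \<open>D + 1\<close>.\<close>
    have "add_mset g1 (add_mset g2 T2) \<notin> atoms (zero_sum_monoid G)"
      using atom_size_le_davenport[OF fin] s2 by fastforce
    then obtain X Y where XY: "X \<in> atoms (zero_sum_monoid G)" "Y \<in> atoms (zero_sum_monoid G)"
      "add_mset g1 (add_mset g2 T2) = X + Y"
      using split_two_atoms[OF U2] c by metis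
    let ?M = "add_mset (g1 \<otimes> g2) T1"
    have "Q = ?M + add_mset g1 (add_mset g2 T2) + (?n V1 + ?n V2)"
      by (simp add: Q_def V1_def V2_def add_mset_commute)
    then have "\<Sum>\<^sub># {#?M, X, Y, ?n V1, ?n V2#} = Q" using XY by (simp add: add_ac)
    then show ?thesis
      using merged_atom[OF U1] XY V by (intro in_lengthsI[of "{#?M, X, Y, ?n V1, ?n V2#}"]) auto
  qed
  moreover have "2 * ?D - 1 \<in> lengths Q"
  proof -
    \<comment> \<open>\<open>Q\<close> consists of \<open>2 * D\<close> pairs; those of \<open>g1\<close>, \<open>g2\<close> and \<open>g1 \<otimes> g2\<close> also form two atoms.\<close>
    let ?W = "{#g1, g2, inv (g1 \<otimes> g2)#}"
    have W: "?W \<in> atoms (zero_sum_monoid G)" using triple_atom c n1 by simp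
    have "2 \<in> lengths (?W + ?n ?W)"
      using two_in_lengths[OF W inv_atom[OF W]] .
    moreover have "size (T1 + T2) \<in> lengths ((T1 + T2) + ?n (T1 + T2))"
      using c n1 by (intro pairing_length) auto
    ultimately have "2 + size (T1 + T2) \<in> lengths ((?W + ?n ?W) + ((T1 + T2) + ?n (T1 + T2)))"
      by (rule lengths_add)
    moreover have "(?W + ?n ?W) + ((T1 + T2) + ?n (T1 + T2)) = Q"
      using c by (simp add: Q_def V1_def V2_def add_mset_commute add_ac)
    moreover have "2 + size (T1 + T2) = 2 * ?D - 1" using s1 s2 by simp
    ultimately show ?thesis by metis
  qed
  ultimately show ?thesis using D3 by blast
qed


text \<open>The element is \<open>Q\<close> to the power \<open>N = D * D\<close>. The step between the two groups of lengths of \<open>Q\<close>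
  is \<open>m = 2 * D - 5 \<le> N\<close>, and the interval from \<open>4 * N\<close> to \<open>2 * D * N\<close> is longer than the bound \<open>D * D\<close>
  on gaps.\<close>

lemma ex_long_interval:
  assumes fin: "finite (carrier G)"
    and U1: "add_mset g1 (add_mset g2 T1) \<in> atoms (zero_sum_monoid G)"
    and U2: "add_mset (g1 \<otimes> g2) T2 \<in> atoms (zero_sum_monoid G)"
    and s1: "size (add_mset g1 (add_mset g2 T1)) = davenport G"
    and s2: "size (add_mset (g1 \<otimes> g2) T2) = davenport G"
  obtains B p q where "B \<in> carrier (zero_sum_monoid G)" "0 < p" "{p..q} \<subseteq> lengths B"
    "2 * q = davenport G * p" "p + davenport G * davenport G \<le> q"
proof -
  let ?D = "davenport G"
  obtain Q where D: "3 \<le> ?D" and Q: "Q \<in> carrier (zero_sum_monoid G)"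
    "{4, 5, 2 * ?D - 1, 2 * ?D} \<subseteq> lengths Q"
    using ex_four_lengths[OF assms] by blast
  define N m where "N = ?D * ?D" and "m = 2 * ?D - 5"
  have "3 * ?D \<le> N" unfolding N_def using D by simp
  then have N: "m \<le> N" "0 < N" "0 < m" using D by (auto simp: m_def)
  have eqs: "4 + 1 = (5 :: nat)" "4 + m = 2 * ?D - 1" "2 * ?D - 1 + 1 = 2 * ?D" using D by (auto simp: m_def)
  have "{4, 4 + 1, 4 + m, 4 + m + 1} \<subseteq> lengths Q" unfolding eqs by (rule Q(2))
  from interval_lengths_repeat_mset[OF this N(1,3)]
  have int: "{4 * N..2 * ?D * N} \<subseteq> lengths (repeat_mset N Q)" unfolding eqs .
  have "repeat_mset n Q \<in> carrier (zero_sum_monoid G)" for n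
    by (induction n) (simp_all add: zero_sum_empty zero_sum_union Q(1))
  moreover have "4 * N + N \<le> 2 * ?D * N"
    using D mult_le_mono1[of 5 "2 * ?D" N] by simp
  ultimately show thesis
    using that[of "repeat_mset N Q" "4 * N" "2 * ?D * N"] N int by (simp add: N_def)
qed

text \<open>A length of \<open>A\<close> lies in every window of \<open>D * D + 1\<close> consecutive numbers between \<open>Min\<close> and
  \<open>Max\<close>, so translates of the interval from \<open>p\<close> to \<open>q\<close> by the lengths of \<open>A\<close> overlap and fill the right-hand
  side. Since the ratio of the end points is the extreme value \<open>D / 2\<close>, a length outside would
  violate \<open>lengths_ratio\<close> against the opposite end point.\<close>

lemma lengths_sum_interval:
  assumes fin: "finite (carrier G)" and D: "2 \<le> davenport G"
    and B: "{p..q} \<subseteq> lengths B" "2 * q = davenport G * p" "p + davenport G * davenport G \<le> q"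
    and A: "A \<in> carrier (zero_sum_monoid G)" "2 * Max (lengths A) = davenport G * Min (lengths A)"
  shows "lengths (B + A) = {p + Min (lengths A)..q + Max (lengths A)}"
proof -
  let ?D = "davenport G" and ?m = "Min (lengths A)" and ?M = "Max (lengths A)"
  note ratio = lengths_ratio[OF fin D]
  have ne: "lengths A \<noteq> {}" using ex_length[OF A(1)] by blast
  have finA: "finite (lengths A)" by (rule finite_lengths[OF fin D])
  have m: "?m \<in> lengths A" and M: "?M \<in> lengths A" using finA ne by auto
  have pq: "p \<in> lengths B" "q \<in> lengths B" using B by auto
  have lo: "p + ?m \<in> lengths (B + A)" and hi: "q + ?M \<in> lengths (B + A)"
    using lengths_add m M pq by auto
  have "p + ?m \<le> n \<and> n \<le> q + ?M" if n: "n \<in> lengths (B + A)" for n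
  proof
    have "2 * (q + ?M) = ?D * (p + ?m)" using A B by (simp add: algebra_simps)
    then have "?D * (p + ?m) \<le> ?D * n" "2 * n \<le> 2 * (q + ?M)" using ratio[OF n hi] ratio[OF lo n] by simp_all
    then show "p + ?m \<le> n" "n \<le> q + ?M" using D by auto
  qed
  moreover have "n \<in> lengths (B + A)" if n: "p + ?m \<le> n" "n \<le> q + ?M" for n
  proof -
    have *: ?thesis if l: "l \<in> lengths A" "p + l \<le> n" "n \<le> q + l" for l
    proof -
      have "n - l \<in> {p..q}" using l by auto
      then have "n - l \<in> lengths B" using B(1) by blast
      from lengths_add[OF this l(1)] show ?thesis using l(2) by simp
    qed
    show ?thesis
    proof (cases "n - p \<le> ?M")
      case True
      obtain Z Z' where Z: "set_mset Z \<subseteq> atoms (zero_sum_monoid G)" "\<Sum>\<^sub># Z = A" "size Z = ?m"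
        "set_mset Z' \<subseteq> atoms (zero_sum_monoid G)" "\<Sum>\<^sub># Z' = A" "size Z' = ?M"
        using m M unfolding in_lengths_iff by blast
      have "?m \<le> n - p" using n(1) by simp
      then obtain l where "l \<in> lengths A" "l \<le> n - p" "n - p \<le> l + ?D * ?D"
        using lengths_gap[OF fin Z(1,4), of "n - p"] True unfolding Z(2,3,5,6) by blast
      then show ?thesis using * n B(3) by auto
    next
      case False
      then show ?thesis using *[OF M] n by simp
    qed
  qed
  ultimately show ?thesis unfolding set_eq_iff atLeastAtMost_iff by meson
qed

end


section \<open>Transfer homomorphisms into reduced monoids\<close>

lemma transfer_homomorphism_surj:
  assumes "comm_monoid_cancel B" "Units B = {\<one>\<^bsub>B\<^esub>}" "transfer_homomorphism H B \<theta>" "b \<in> carrier B"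
  shows "\<exists>a \<in> carrier H. \<theta> a = b"
proof -
  interpret B: comm_monoid_cancel B by fact
  have "carrier B = (\<theta> ` carrier H) <#>\<^bsub>B\<^esub> {\<one>\<^bsub>B\<^esub>}" and hom: "\<theta> \<in> hom H B"
    using assms(2,3) unfolding transfer_homomorphism_def by argo+
  then have "b \<in> (\<theta> ` carrier H) <#>\<^bsub>B\<^esub> {\<one>\<^bsub>B\<^esub>}" using assms(4) by argo
  then obtain a where "a \<in> carrier H" "b = \<theta> a \<otimes>\<^bsub>B\<^esub> \<one>\<^bsub>B\<^esub>"
    unfolding set_mult_def by blast
  then show ?thesis using hom_in_carrier[OF hom] by auto
qed

lemma factors_atoms_iff:
  "set us \<subseteq> carrier M \<and> factors M us x \<longleftrightarrow>
    set us \<subseteq> atoms M \<and> foldr (\<otimes>\<^bsub>M\<^esub>) us \<one>\<^bsub>M\<^esub> = x"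
  by (auto simp: factors_def atoms_def)

text \<open>Atoms correspond to atoms in both directions, so factorizations can be mapped down; they
  are lifted by splitting off one atom after the other. Lifting stops at the last atom rather than at
  the empty product, because the element left over by an empty product is in general only a unit and not \<open>\<one>\<close>.\<close>

lemma transfer_length_set:
  assumes H: "comm_monoid_cancel H" and B: "comm_monoid_cancel B" and red: "Units B = {\<one>\<^bsub>B\<^esub>}"
    and tr: "transfer_homomorphism H B \<theta>" and a: "a \<in> carrier H"
  shows "length_set H a = length_set B (\<theta> a)"
proof -
  interpret H: comm_monoid_cancel H by fact
  interpret B: comm_monoid_cancel B by fact
  have hom: "\<theta> \<in> hom H B" using tr by (simp add: transfer_homomorphism_def)
  have cl: "\<theta> x \<in> carrier B" if "x \<in> carrier H" for x
    using hom that by (simp add: hom_def Pi_iff)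
  have mult: "\<theta> (x \<otimes>\<^bsub>H\<^esub> y) = \<theta> x \<otimes>\<^bsub>B\<^esub> \<theta> y" if "x \<in> carrier H" "y \<in> carrier H" for x y
    using hom that by (simp add: hom_def Pi_iff)
  have one: "\<theta> \<one>\<^bsub>H\<^esub> = \<one>\<^bsub>B\<^esub>" using tr by (simp add: transfer_homomorphism_def)
  have unit: "x \<in> Units H \<longleftrightarrow> \<theta> x = \<one>\<^bsub>B\<^esub>" if "x \<in> carrier H" for x
  proof -
    have "{u \<in> carrier H. \<theta> u \<in> Units B} = Units H"
      using tr unfolding transfer_homomorphism_def by blast
    then show ?thesis using that red by blast
  qed
  have assoc: "b = c" if "b \<sim>\<^bsub>B\<^esub> c" "b \<in> carrier B" "c \<in> carrier B" for b c
    using B.associatedD2[OF that] red that by auto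
  have split: "\<forall>u \<in> carrier H. \<forall>b \<in> carrier B. \<forall>c \<in> carrier B. \<theta> u = b \<otimes>\<^bsub>B\<^esub> c \<longrightarrow>
      (\<exists>v \<in> carrier H. \<exists>w \<in> carrier H. u = v \<otimes>\<^bsub>H\<^esub> w \<and> \<theta> v \<sim>\<^bsub>B\<^esub> b \<and> \<theta> w \<sim>\<^bsub>B\<^esub> c)"
    using tr unfolding transfer_homomorphism_def by argo
  have lift: "\<exists>v \<in> carrier H. \<exists>w \<in> carrier H. u = v \<otimes>\<^bsub>H\<^esub> w \<and> \<theta> v = b \<and> \<theta> w = c"
    if ubc: "u \<in> carrier H" "b \<in> carrier B" "c \<in> carrier B" "\<theta> u = b \<otimes>\<^bsub>B\<^esub> c" for u b c
  proof -
    obtain v w where "v \<in> carrier H" "w \<in> carrier H" "u = v \<otimes>\<^bsub>H\<^esub> w" "\<theta> v \<sim>\<^bsub>B\<^esub> b" "\<theta> w \<sim>\<^bsub>B\<^esub> c"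
      using split[rule_format, OF ubc] by blast
    then show ?thesis using assoc cl ubc by blast
  qed
  have atom: "u \<in> atoms H \<longleftrightarrow> \<theta> u \<in> atoms B" if u: "u \<in> carrier H" for u
  proof
    assume U: "u \<in> atoms H"
    have "b \<in> Units B \<or> c \<in> Units B"
      if bc: "b \<in> carrier B" "c \<in> carrier B" "\<theta> u = b \<otimes>\<^bsub>B\<^esub> c" for b c
    proof -
      obtain v w where "v \<in> carrier H" "w \<in> carrier H" "u = v \<otimes>\<^bsub>H\<^esub> w" "\<theta> v = b" "\<theta> w = c"
        using lift u bc by blast
      then show ?thesis using U unit red unfolding H.atoms_iff by blast
    qed
    then show "\<theta> u \<in> atoms B" using U u unit cl red unfolding H.atoms_iff B.atoms_iff by blast
  next
    assume U: "\<theta> u \<in> atoms B"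
    have "b \<in> Units H \<or> c \<in> Units H"
      if "b \<in> carrier H" "c \<in> carrier H" "u = b \<otimes>\<^bsub>H\<^esub> c" for b c
      using U that mult[of b c] cl[of b] cl[of c] unit[of b] unit[of c] red unfolding B.atoms_iff by auto
    then show "u \<in> atoms H" using U u unit red unfolding H.atoms_iff B.atoms_iff by blast
  qed
  have down: "foldr (\<otimes>\<^bsub>B\<^esub>) (map \<theta> us) \<one>\<^bsub>B\<^esub> = \<theta> (foldr (\<otimes>\<^bsub>H\<^esub>) us \<one>\<^bsub>H\<^esub>)"
    if "set us \<subseteq> carrier H" for us
    using that by (induction us) (auto simp: one mult H.multlist_closed)
  have up: "\<exists>us. set us \<subseteq> atoms H \<and> foldr (\<otimes>\<^bsub>H\<^esub>) us \<one>\<^bsub>H\<^esub> = x \<and> length us = length bs"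
    if "bs \<noteq> []" "set bs \<subseteq> atoms B" "foldr (\<otimes>\<^bsub>B\<^esub>) bs \<one>\<^bsub>B\<^esub> = \<theta> x" "x \<in> carrier H" for bs x
    using that
  proof (induction bs arbitrary: x rule: list_nonempty_induct)
    case (single b)
    then have "\<theta> x = b" by (simp add: atoms_def)
    then show ?case using single atom by (intro exI[of _ "[x]"]) auto
  next
    case (cons b bs)
    have "b \<in> carrier B" "set bs \<subseteq> carrier B" using cons.prems by (auto simp: atoms_def)
    then obtain v w where vw: "v \<in> carrier H" "w \<in> carrier H" "x = v \<otimes>\<^bsub>H\<^esub> w" "\<theta> v = b"
      "\<theta> w = foldr (\<otimes>\<^bsub>B\<^esub>) bs \<one>\<^bsub>B\<^esub>"
      using lift[of x b "foldr (\<otimes>\<^bsub>B\<^esub>) bs \<one>\<^bsub>B\<^esub>"] cons.prems B.multlist_closed by auto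
    then obtain us where "set us \<subseteq> atoms H" "foldr (\<otimes>\<^bsub>H\<^esub>) us \<one>\<^bsub>H\<^esub> = w" "length us = length bs"
      using cons.IH[of w] cons.prems by auto
    then show ?case using vw atom cons.prems by (intro exI[of _ "v # us"]) auto
  qed
  show ?thesis
  proof (cases "a \<in> Units H")
    case True
    then show ?thesis using a unit red by (simp add: length_set_def)
  next
    case False
    then have nB: "\<theta> a \<notin> Units B" "\<theta> a \<noteq> \<one>\<^bsub>B\<^esub>" using a unit red by auto
    have "(\<exists>us. set us \<subseteq> atoms H \<and> foldr (\<otimes>\<^bsub>H\<^esub>) us \<one>\<^bsub>H\<^esub> = a \<and> length us = n) \<longleftrightarrow>
      (\<exists>bs. set bs \<subseteq> atoms B \<and> foldr (\<otimes>\<^bsub>B\<^esub>) bs \<one>\<^bsub>B\<^esub> = \<theta> a \<and> length bs = n)" (is "?L \<longleftrightarrow> ?R") for n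
    proof
      assume ?L
      then obtain us where us: "set us \<subseteq> atoms H" "foldr (\<otimes>\<^bsub>H\<^esub>) us \<one>\<^bsub>H\<^esub> = a" "length us = n" by blast
      then have c: "set us \<subseteq> carrier H" by (auto simp: atoms_def)
      then have "set (map \<theta> us) \<subseteq> atoms B" using us atom by auto
      then show ?R using us down[OF c] by (intro exI[of _ "map \<theta> us"]) auto
    next
      assume ?R
      then obtain bs where bs: "set bs \<subseteq> atoms B" "foldr (\<otimes>\<^bsub>B\<^esub>) bs \<one>\<^bsub>B\<^esub> = \<theta> a" "length bs = n" by blast
      then have "bs \<noteq> []" using nB by auto
      then show ?L using up bs a by blast
    qed
    then show ?thesis using False nB by (simp add: length_set_def factors_atoms_iff set_eq_iff) metis
  qed
qed


section \<open>Length sets of maximal elasticity\<close>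

theorem theorem1p1:
  fixes G :: "('g, 'm) monoid_scheme" and H :: "('h, 'n) monoid_scheme"
  assumes "comm_group G" and "finite (carrier G)" and "order G \<ge> 3"
    and "transfer_krull_monoid H G"
    and "\<exists>g1 \<in> carrier G. \<exists>g2 \<in> carrier G.
      \<exists>U1 \<in> atoms (zero_sum_monoid G). \<exists>U2 \<in> atoms (zero_sum_monoid G).
        size U1 = davenport G \<and> size U2 = davenport G \<and>
        {#g1, g2#} divides\<^bsub>seq_monoid G\<^esub> U1 \<and>
        {#g1 \<otimes>\<^bsub>G\<^esub> g2#} divides\<^bsub>seq_monoid G\<^esub> U2"
  shows "\<exists>a' \<in> carrier H. \<forall>a \<in> carrier H.
    set_elasticity (length_set H a) = elasticity H \<longrightarrow>
      nat_interval (length_set H (a' \<otimes>\<^bsub>H\<^esub> a)) \<and>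
      set_elasticity (length_set H (a' \<otimes>\<^bsub>H\<^esub> a)) = elasticity H"
proof -
  interpret comm_group G by fact
  let ?M = "zero_sum_monoid G" and ?D = "davenport G"
  note fin = \<open>finite (carrier G)\<close>
  obtain \<theta> where H: "comm_monoid_cancel H" and \<theta>: "transfer_homomorphism H ?M \<theta>"
    using assms(4) by (auto simp: transfer_krull_monoid_def)
  interpret H: comm_monoid_cancel H by (rule H)
  have hom: "\<theta> \<in> hom H ?M" using \<theta> by (simp add: transfer_homomorphism_def)
  have L: "length_set H a = lengths (\<theta> a)" if "a \<in> carrier H" for a
    using transfer_length_set[OF H zero_sum_monoid_cancel _ \<theta> that] zero_sum_monoid_Units by simp
  obtain g1 g2 T1 T2 where g: "add_mset g1 (add_mset g2 T1) \<in> atoms ?M"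
    "add_mset (g1 \<otimes>\<^bsub>G\<^esub> g2) T2 \<in> atoms ?M"
    "size (add_mset g1 (add_mset g2 T1)) = ?D" "size (add_mset (g1 \<otimes>\<^bsub>G\<^esub> g2) T2) = ?D"
    using assms(5) by (fastforce simp: factor_def seq_monoid_def)
  have D: "2 \<le> ?D" using g(3) by simp
  obtain B p q where B: "B \<in> carrier ?M" "0 < p" "{p..q} \<subseteq> lengths B" "2 * q = ?D * p" "p + ?D * ?D \<le> q"
    using ex_long_interval[OF fin g] .
  have quot: "ereal (real u / real v) = ereal (real ?D / 2)" if "2 * u = ?D * v" "0 < v" for u v
  proof -
    have "2 * real u = real ?D * real v" using that(1) by (metis of_nat_mult of_nat_numeral)
    then show ?thesis using that(2) by (simp add: field_simps)
  qed
  have elast: "set_elasticity {p + k..q + l} = ereal (real ?D / 2)" if "2 * l = ?D * k" for k l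
  proof -
    have eq: "2 * (q + l) = ?D * (p + k)" using B(4) that by (simp add: algebra_simps)
    moreover have "2 * (p + k) \<le> ?D * (p + k)" using D by (rule mult_le_mono1)
    ultimately have "2 * (p + k) \<le> 2 * (q + l)" by (simp only:)
    then have "p + k \<le> q + l" by simp
    then have "Max {p + k..q + l} = q + l" "Min {p + k..q + l} = p + k"
      by (auto intro!: Max_eqI Min_eqI)
    then show ?thesis using quot[OF eq] B(2) by (simp add: set_elasticity_def del: ereal.inject)
  qed
  obtain a' where a': "a' \<in> carrier H" "\<theta> a' = B"
    using transfer_homomorphism_surj[OF zero_sum_monoid_cancel _ \<theta> B(1)] zero_sum_monoid_Units by auto
  have empty: "lengths {#} = {0}"
    by (simp add: length_set_def zero_sum_monoid_Units)
  have elH: "elasticity H = ereal (real ?D / 2)"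
    unfolding elasticity_def
  proof (rule antisym)
    show "(SUP a \<in> carrier H - Units H. set_elasticity (length_set H a)) \<le> ereal (real ?D / 2)"
    proof (rule SUP_least)
      fix a assume "a \<in> carrier H - Units H"
      then have a: "a \<in> carrier H" by simp
      let ?L = "lengths (\<theta> a)"
      have "?L \<noteq> {}" using ex_length hom_in_carrier[OF hom a] by blast
      moreover have finL: "finite ?L" by (rule finite_lengths[OF fin D])
      ultimately have "2 * Max ?L \<le> ?D * Min ?L"
        by (intro lengths_ratio[OF fin D Min_in Max_in])
      then have "real (2 * Max ?L) \<le> real (?D * Min ?L)" by (rule of_nat_mono)
      then have "real (Max ?L) / real (Min ?L) \<le> real ?D / 2"
        by (cases "Min ?L = 0") (simp_all add: field_simps)
      then show "set_elasticity (length_set H a) \<le> ereal (real ?D / 2)"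
        using finL by (simp add: L[OF a] set_elasticity_def)
    qed
    \<comment> \<open>The bound is attained at \<open>a'\<close>, by the interval lemma with the empty sequence for \<open>A\<close>.\<close>
    have "lengths (B + {#}) = {p + 0..q + 0}"
      using lengths_sum_interval[OF fin D B(3-5) zero_sum_empty] empty by simp
    then have LB: "length_set H a' = {p + 0..q + 0}" using L a' by simp
    have "a' \<notin> Units H"
    proof
      assume "a' \<in> Units H"
      then have "{p..q} = {0}" using LB by (simp add: length_set_def)
      moreover have "p \<in> {p..q}" using B(5) by simp
      ultimately have "p \<in> {0}" by (simp only:)
      then show False using B(2) by simp
    qed
    then have "a' \<in> carrier H - Units H" using a' by simp
    from SUP_upper[OF this, of "\<lambda>a. set_elasticity (length_set H a)"]
    show "ereal (real ?D / 2) \<le> (SUP a \<in> carrier H - Units H. set_elasticity (length_set H a))"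
      unfolding LB using elast[of 0 0] by simp
  qed
  have "nat_interval (length_set H (a' \<otimes>\<^bsub>H\<^esub> a)) \<and>
      set_elasticity (length_set H (a' \<otimes>\<^bsub>H\<^esub> a)) = elasticity H"
    if a: "a \<in> carrier H" and el: "set_elasticity (length_set H a) = elasticity H" for a
  proof -
    let ?L = "lengths (\<theta> a)"
    have finL: "finite ?L" by (rule finite_lengths[OF fin D])
    have "real (Max ?L) / real (Min ?L) = real ?D / 2"
      using el finL by (simp add: L[OF a] elH set_elasticity_def)
    \<comment> \<open>This excludes units, for which the quotient is \<open>0 / 0 = 0\<close>.\<close>
    moreover from this have "Min ?L \<noteq> 0" using D by (intro notI) simp
    ultimately have "real (2 * Max ?L) = real (?D * Min ?L)" by (simp add: field_simps)
    then have max: "2 * Max ?L = ?D * Min ?L" by (rule of_nat_eq_iff[THEN iffD1])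
    have "\<theta> (a' \<otimes>\<^bsub>H\<^esub> a) = B + \<theta> a" using hom_mult[OF hom a'(1) a] a' by simp
    then have eq: "length_set H (a' \<otimes>\<^bsub>H\<^esub> a) = {p + Min ?L..q + Max ?L}"
      using lengths_sum_interval[OF fin D B(3-5) hom_in_carrier[OF hom a] max] L a a' by simp
    have "{p + Min ?L..q + Max ?L} \<noteq> {}"
      using eq ex_length[OF zero_sum_union[OF B(1) hom_in_carrier[OF hom a]]] \<open>\<theta> (a' \<otimes>\<^bsub>H\<^esub> a) = B + \<theta> a\<close>
        L[of "a' \<otimes>\<^bsub>H\<^esub> a"] a a' by auto
    then have "p + Min ?L \<le> q + Max ?L" by simp
    then show ?thesis unfolding eq elH using elast[OF max] by (auto simp: nat_interval_def)
  qed
  then show ?thesis using a'(1) by blast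
qed

end
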